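(* Let $\delta\in(0,\frac14)$ and $\hat\theta_0=\pi/2$. Consider $\tilde P^{\hat\nu_\delta}(\hat\theta)$ with $$\hat\nu_\delta=\left\lceil\log_2\left(-6+2\sqrt{1+2/\delta}\right)\right\rceil$$ and with angles $\hat\theta_j=\operatorname{arcsec}(\hat c_j/\hat b_j)$, $j=1,\dots,\hat\nu_\delta$, where $(\hat a_1,\hat b_1,\hat c_1)=(120,119,169)$ and, for $j\ge2$, $(\hat a_j,\hat b_j,\hat c_j)=(2h_j-1,\,2h_j^2-2h_j,\,2h_j^2-2h_j+1)$ with $h_j=2^{j-2}+2$. Then $$L^3\subseteq\tilde P^{\hat\nu_\delta}(\hat\theta)\subseteq(1+\delta)L^3 .$$ Moreover, $$\hat\nu_\delta\le\nu_\delta+2,\qquad\text{where }\nu_\delta=\left\lceil\log_2\frac{\pi}{2\operatorname{arcsec}(1+\delta)}\right\rceil .$$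
   Context: $L^3=\{x\in\mathbb{R}^3:\sqrt{x_1^2+x_2^2}\le x_3\}$, and for $\lambda\ge 1$ the notation $\lambda L^3$ denotes the relaxed cone $\{x\in\mathbb{R}^3:\sqrt{x_1^2+x_2^2}\le\lambda x_3\}$ (not the pointwise scaling of $L^3$). Here $\operatorname{arcsec}:[1,\infty)\to[0,\pi/2)$ is the inverse of $\sec$. For a positive integer $\nu$ and angles $\theta_j\in(0,\pi/2)$ with $\sin(\theta_j)=a_j/c_j$, $\cos(\theta_j)=b_j/c_j$ for positive coprime integers $a_j,b_j,c_j$, $j=1,\dots,\nu$, $\tilde P^\nu(\theta)$ is the set of $x\in\mathbb{R}^3$ for which there exist reals $\xi^j,\eta^j$, $j=0,\dots,\nu$, satisfying - $\xi^0\ge|x_1|$, $\eta^0\ge|x_2|$; - $c_j\xi^j=b_j\xi^{j-1}+a_j\eta^{j-1}$ for $j=1,\dots,\nu$; - $c_j\eta^j\ge|-a_j\xi^{j-1}+b_j\eta^{j-1}|$ for $j=1,\dots,\nu$; - $\xi^\nu\le x_3$ and $b_\nu\eta^\nu\le a_\nu\xi^\nu$. For the angles $\hat\theta_j$, the corresponding integers are $(a_j,b_j,c_j)=(\hat a_j,\hat b_j,\hat c_j)$.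
   Formalization: The inner inclusion is stated when ν̂_δ≥1 (else P̃ is undefined) and the outer one only when ν̂_δ≥2, i.e. δ<2/15: for ν̂_δ=1 it is false, as (169/119,0,1) lies in P̃^1 but not in (1+δ)L³. *)

theory Defs
  imports "HOL-Analysis.Analysis"
begin

definition L3 :: "(real ^ 3) set" where
  "L3 = {x. sqrt ((x $ 1)\<^sup>2 + (x $ 2)\<^sup>2) \<le> x $ 3}"

(* The relaxation acts on the third coordinate only; this is not the pointwise scaling of L3. *)
definition relaxed_L3 :: "real \<Rightarrow> (real ^ 3) set" where
  "relaxed_L3 l = {x. sqrt ((x $ 1)\<^sup>2 + (x $ 2)\<^sup>2) \<le> l * x $ 3}"

(* Inverse of the secant on [0, pi/2); only meaningful for arguments at least 1. *)
definition arcsec :: "real \<Rightarrow> real" where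
  "arcsec = the_inv_into {0..<pi / 2} (\<lambda>t. 1 / cos t)"

definition pyth_angle :: "real \<Rightarrow> int \<Rightarrow> int \<Rightarrow> int \<Rightarrow> bool" where
  "pyth_angle t a b c \<longleftrightarrow>
     0 < t \<and> t < pi / 2 \<and> 0 < a \<and> 0 < b \<and> 0 < c \<and> gcd a (gcd b c) = 1 \<and>
     sin t = of_int a / of_int c \<and> cos t = of_int b / of_int c"

(* The integers are determined by the angles (pyth_angle_unique below), so quantifying them
   existentially only names them. The set is meant for nu > 0 and angles t 1, ..., t nu for which
   such integers exist; only the values of xi and eta at 0, ..., nu matter. *)
definition P_tilde :: "nat \<Rightarrow> (nat \<Rightarrow> real) \<Rightarrow> (real ^ 3) set" where
  "P_tilde nu t = {x. \<exists>(a :: nat \<Rightarrow> int) (b :: nat \<Rightarrow> int) (c :: nat \<Rightarrow> int).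
     (\<forall>j\<in>{1..nu}. pyth_angle (t j) (a j) (b j) (c j)) \<and>
     (\<exists>(xi :: nat \<Rightarrow> real) (eta :: nat \<Rightarrow> real).
        xi 0 \<ge> \<bar>x $ 1\<bar> \<and> eta 0 \<ge> \<bar>x $ 2\<bar> \<and>
        (\<forall>j\<in>{1..nu}. of_int (c j) * xi j = of_int (b j) * xi (j - 1) + of_int (a j) * eta (j - 1)) \<and>
        (\<forall>j\<in>{1..nu}. of_int (c j) * eta j \<ge>
            \<bar>- of_int (a j) * xi (j - 1) + of_int (b j) * eta (j - 1)\<bar>) \<and>
        xi nu \<le> x $ 3 \<and> of_int (b nu) * eta nu \<le> of_int (a nu) * xi nu)}"

(* hat_h is only used for j >= 2, and hat_a, hat_b, hat_c only for j >= 1; the values at smaller j,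
   where j - 2 truncates, are irrelevant. *)
definition hat_h :: "nat \<Rightarrow> int" where
  "hat_h j = 2 ^ (j - 2) + 2"

definition hat_a :: "nat \<Rightarrow> int" where
  "hat_a j = (if j = 1 then 120 else 2 * hat_h j - 1)"

definition hat_b :: "nat \<Rightarrow> int" where
  "hat_b j = (if j = 1 then 119 else 2 * (hat_h j)\<^sup>2 - 2 * hat_h j)"

definition hat_c :: "nat \<Rightarrow> int" where
  "hat_c j = (if j = 1 then 169 else 2 * (hat_h j)\<^sup>2 - 2 * hat_h j + 1)"

definition hat_theta :: "nat \<Rightarrow> real" where
  "hat_theta j = (if j = 0 then pi / 2 else arcsec (of_int (hat_c j) / of_int (hat_b j)))"

definition hat_nu :: "real \<Rightarrow> int" where
  "hat_nu d = \<lceil>log 2 (- 6 + 2 * sqrt (1 + 2 / d))\<rceil>"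

definition nu_opt :: "real \<Rightarrow> int" where
  "nu_opt d = \<lceil>log 2 (pi / (2 * arcsec (1 + d)))\<rceil>"

lemma arcsec_eq_arccos:
  assumes "1 \<le> y"
  shows "arcsec y = arccos (1 / y)"
proof -
  have inj: "inj_on (\<lambda>t. 1 / cos t) {0..<pi / 2}"
  proof (rule inj_onI)
    fix s t :: real
    assume st: "s \<in> {0..<pi / 2}" "t \<in> {0..<pi / 2}" "1 / cos s = 1 / cos t"
    from st(3) have "cos s = cos t" by simp
    then have "arccos (cos s) = arccos (cos t)" by simp
    then show "s = t" using st(1,2) by (simp add: arccos_cos)
  qed
  have "0 \<le> arccos (1 / y)" "arccos (1 / y) < pi / 2"
  proof -
    have y: "0 < 1 / y" "1 / y \<le> 1" using assms by auto
    show "0 \<le> arccos (1 / y)" using y by (intro arccos_lbound) linarith+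
    show "arccos (1 / y) < pi / 2" using y arccos_less_arccos[of 0 "1 / y"] by simp
  qed
  moreover have "1 / cos (arccos (1 / y)) = y"
  proof -
    have "0 < 1 / y" "1 / y \<le> 1" using assms by auto
    then have "cos (arccos (1 / y)) = 1 / y" by (intro cos_arccos) linarith+
    then show ?thesis by simp
  qed
  ultimately show ?thesis
    unfolding arcsec_def by (intro the_inv_into_f_eq[OF inj]) auto
qed

lemma pyth_angle_unique:
  assumes "pyth_angle t a b c" "pyth_angle t a' b' c'"
  shows "a = a' \<and> b = b' \<and> c = c'"
proof -
  have pos: "0 < a" "0 < b" "0 < c" "0 < a'" "0 < b'" "0 < c'"
    and g: "gcd a (gcd b c) = 1" "gcd a' (gcd b' c') = 1"
    using assms by (auto simp: pyth_angle_def)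
  have "real_of_int a / of_int c = of_int a' / of_int c'"
    and "real_of_int b / of_int c = of_int b' / of_int c'"
    using assms by (auto simp: pyth_angle_def)
  then have "real_of_int (a * c') = of_int (a' * c)" "real_of_int (b * c') = of_int (b' * c)"
    using pos by (auto simp: field_simps)
  then have e: "a * c' = a' * c" "b * c' = b' * c" by (simp_all only: of_int_eq_iff)
  have "c' = c' * gcd a (gcd b c)" using g by simp
  also have "\<dots> = gcd (c' * a) (gcd (c' * b) (c' * c))"
    using pos by (simp add: gcd_mult_left)
  also have "\<dots> = gcd (c * a') (gcd (c * b') (c * c'))"
    using e by (simp add: mult.commute)
  also have "\<dots> = c * gcd a' (gcd b' c')"
    using pos by (simp add: gcd_mult_left)
  also have "\<dots> = c" using g by simp
  finally have "c' = c" .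
  then show ?thesis using e pos by simp
qed

lemma pyth_angle_arcsec:
  assumes "0 < a" "0 < b" "0 < c" "gcd a (gcd b c) = (1 :: int)" "a\<^sup>2 + b\<^sup>2 = c\<^sup>2"
  shows "pyth_angle (arcsec (of_int c / of_int b)) a b c"
proof -
  have "b\<^sup>2 < c\<^sup>2" using assms(1,5) by (metis less_add_same_cancel2 zero_less_power)
  then have bc: "b < c" using assms(3) by (simp add: power_less_imp_less_base)
  let ?u = "real_of_int b / of_int c"
  have u: "0 < ?u" "?u < 1" using assms bc by auto
  have t: "arcsec (of_int c / of_int b) = arccos ?u"
    using arcsec_eq_arccos[of "of_int c / of_int b"] assms bc by simp
  have r: "(real_of_int a)\<^sup>2 + (of_int b)\<^sup>2 = (of_int c)\<^sup>2"
    using arg_cong[OF assms(5), of real_of_int] by simp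
  have "1 - ?u\<^sup>2 = (real_of_int a / of_int c)\<^sup>2"
    using r assms(3) by (simp add: power_divide field_simps)
  then have s: "sin (arccos ?u) = of_int a / of_int c"
  proof -
    have "sin (arccos ?u) = sqrt (1 - ?u\<^sup>2)" using u by (intro sin_arccos) linarith+
    also have "\<dots> = \<bar>real_of_int a / of_int c\<bar>"
      using \<open>1 - ?u\<^sup>2 = _\<close> by (simp only: real_sqrt_abs)
    finally show ?thesis using assms by simp
  qed
  have "0 < arccos ?u" "arccos ?u < pi / 2"
    using u arccos_less_arccos[of 0 ?u] arccos_less_arccos[of ?u 1] by simp_all
  moreover have "cos (arccos ?u) = ?u" using u by (intro cos_arccos) linarith+
  ultimately show ?thesis
    using assms s unfolding pyth_angle_def t by simp
qed

lemma pyth_angle_hat: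
  assumes "1 \<le> j"
  shows "pyth_angle (hat_theta j) (hat_a j) (hat_b j) (hat_c j)"
proof (cases "j = 1")
  case True
  let ?g = "gcd (120 :: int) (gcd 119 169)"
  have "?g dvd 120" "?g dvd 119" by (auto intro: dvd_trans)
  then have "?g dvd 120 - 119" by (rule dvd_diff)
  moreover have "120 - 119 = (1 :: int)" by simp
  ultimately have "?g dvd 1" by (simp only:)
  then have "?g = 1" by (simp only: is_unit_gcd coprime_imp_gcd_eq_1)
  then show ?thesis
    using pyth_angle_arcsec[of 120 119 169]
    by (simp add: True hat_theta_def hat_a_def hat_b_def hat_c_def)
next
  case False
  define h where "h = hat_h j"
  have h: "3 \<le> h" by (simp add: h_def hat_h_def)
  have "0 < 2 * (h * (h - 1))" using h by simp
  then have b: "0 < 2 * h\<^sup>2 - 2 * h" by (simp add: power2_eq_square algebra_simps)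
  have "gcd (2 * h\<^sup>2 - 2 * h) (2 * h\<^sup>2 - 2 * h + 1) = 1" 
    by (simp only: coprime_imp_gcd_eq_1 coprime_add_one_right)
  moreover have "(2 * h - 1)\<^sup>2 + (2 * h\<^sup>2 - 2 * h)\<^sup>2 = (2 * h\<^sup>2 - 2 * h + 1)\<^sup>2"
    by (simp add: power2_eq_square algebra_simps)
  ultimately have "pyth_angle (arcsec (of_int (2 * h\<^sup>2 - 2 * h + 1) / of_int (2 * h\<^sup>2 - 2 * h)))
      (2 * h - 1) (2 * h\<^sup>2 - 2 * h) (2 * h\<^sup>2 - 2 * h + 1)"
    using h b by (intro pyth_angle_arcsec) auto
  then show ?thesis
    using assms False by (simp add: hat_theta_def hat_a_def hat_b_def hat_c_def h_def)
qed

(* With a single rotation the approximation is only as tight as 169/119, so the outer inclusion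
   needs hat_nu d >= 2 (equivalently d < 2/15), and the case hat_nu d = 1 occurs. *)
lemma P_tilde_1_not_subset:
  assumes "0 < d" "d < 1 / 4"
  shows "\<not> P_tilde 1 hat_theta \<subseteq> relaxed_L3 (1 + d)"
proof
  assume sub: "P_tilde 1 hat_theta \<subseteq> relaxed_L3 (1 + d)"
  define x :: "real ^ 3" where "x = vector [169 / 119, 0, 1]"
  have x: "x $ 1 = 169 / 119" "x $ 2 = 0" "x $ 3 = 1" by (simp_all add: x_def)
  have "x \<in> P_tilde 1 hat_theta"
    unfolding P_tilde_def using pyth_angle_hat[of 1]
    by (intro CollectI exI[of _ hat_a] exI[of _ hat_b] exI[of _ hat_c] conjI
        exI[of _ "\<lambda>j. if j = 0 then 169 / 119 else 1 :: real"]
        exI[of _ "\<lambda>j. if j = 0 then 0 else 120 / 119 :: real"])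
       (auto simp: x hat_a_def hat_b_def hat_c_def)
  then have "x \<in> relaxed_L3 (1 + d)" using sub by blast
  then show False using assms by (simp add: relaxed_L3_def x)
qed

lemma hat_nu_eq_1: "hat_nu (8 / 55) = 1"
proof -
  have "7 / 2 < sqrt (59 / 4 :: real)"
    by (rule real_less_rsqrt) (simp add: power2_eq_square)
  moreover have "sqrt (59 / 4 :: real) < 4"
    by (rule real_less_lsqrt) auto
  moreover have e: "1 + 2 / (8 / 55) = (59 / 4 :: real)" by simp
  ultimately have "1 < - 6 + 2 * sqrt (1 + 2 / (8 / 55 :: real))"
    "- 6 + 2 * sqrt (1 + 2 / (8 / 55 :: real)) < 2" unfolding e by linarith+
  then have "0 < log 2 (- 6 + 2 * sqrt (1 + 2 / (8 / 55 :: real)))"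
    "log 2 (- 6 + 2 * sqrt (1 + 2 / (8 / 55 :: real))) \<le> 1" by auto
  then show ?thesis unfolding hat_nu_def by (intro ceiling_unique) auto
qed

end

(* In polar coordinates (xi^j, eta^j) = r (cos phi_j, sin phi_j), one step of the construction is
   phi_j = |phi_(j-1) - theta_j| with r unchanged when the inequalities are tight. If
   theta_0 = pi/2 and theta_(j-1) <= 2 theta_j, then phi_j stays in [0, theta_j], which gives the
   inner inclusion. For slack inequalities r can only grow, and the last two constraints bound it
   by x_3 / cos theta_nu, which gives the outer one. For the hat angles 1 / cos theta_nu - 1 = 1 / b_nu
   and 1 + 2 b_nu = (2 h_nu - 1)^2, so b_nu >= 1 / delta is exactly how hat_nu is chosen. Finally, with
   alpha = arcsec (1 + delta), sqrt (1 + 2 / delta) = cot (alpha / 2) <= 2 / alpha compares it to nu. *)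

theory Submission
  imports Defs
begin

section \<open>Both inclusions for general angles\<close>

text \<open>Dividing by \<open>c\<close> turns the integer constraints into a rotation by
  \<open>- t\<close>, so the later arguments can work with \<open>sin t\<close> and
  \<open>cos t\<close> alone.\<close>

lemma pyth_angle_rotation_iff:
  assumes "pyth_angle t a b c"
  shows "of_int c * x' = of_int b * x + of_int a * y \<longleftrightarrow> x' = cos t * x + sin t * y"
    and "of_int c * y' \<ge> \<bar>- of_int a * x + of_int b * y\<bar> \<longleftrightarrow> y' \<ge> \<bar>- sin t * x + cos t * y\<bar>"
    and "of_int b * y \<le> of_int a * x \<longleftrightarrow> cos t * y \<le> sin t * x"
proof -
  have c: "0 < real_of_int c" and sc: "sin t = of_int a / of_int c" "cos t = of_int b / of_int c"
    using assms by (auto simp: pyth_angle_def)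
  show "of_int c * x' = of_int b * x + of_int a * y \<longleftrightarrow> x' = cos t * x + sin t * y"
    and "of_int b * y \<le> of_int a * x \<longleftrightarrow> cos t * y \<le> sin t * x"
    using c by (auto simp: sc field_simps)
  have "- sin t * x + cos t * y = (- of_int a * x + of_int b * y) / of_int c"
    by (simp add: sc diff_divide_distrib)
  then have "\<bar>- sin t * x + cos t * y\<bar> = \<bar>- of_int a * x + of_int b * y\<bar> / of_int c"
    using c by (simp add: abs_divide)
  then show "of_int c * y' \<ge> \<bar>- of_int a * x + of_int b * y\<bar> \<longleftrightarrow> y' \<ge> \<bar>- sin t * x + cos t * y\<bar>"
    using c by (simp add: pos_divide_le_eq mult.commute)
qed

text \<open>Polar form of one tight step: rotate by \<open>- t (Suc j)\<close>, then reflect in the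
  first axis if the angle has become negative.\<close>

primrec fold_angle :: "(nat \<Rightarrow> real) \<Rightarrow> real \<Rightarrow> nat \<Rightarrow> real" where
  "fold_angle t p 0 = p"
| "fold_angle t p (Suc j) = \<bar>fold_angle t p j - t (Suc j)\<bar>"

text \<open>For an angle in [0, \<open>t j\<close>], the distance to \<open>t (Suc j)\<close> is at
  most the larger of \<open>t (Suc j)\<close> and \<open>t j - t (Suc j)\<close>, and halving bounds
  the latter by \<open>t (Suc j)\<close>.\<close>

lemma fold_angle_bounds:
  assumes "0 \<le> p" "p \<le> t 0" and "\<And>j. j < n \<Longrightarrow> t j \<le> 2 * t (Suc j)"
  shows "j \<le> n \<Longrightarrow> 0 \<le> fold_angle t p j \<and> fold_angle t p j \<le> t j"
proof (induction j)
  case (Suc j)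
  then show ?case using assms(3)[of j] by auto
qed (use assms in simp)

lemma L3_subset_P_tilde:
  assumes "1 \<le> nu" and t0: "t 0 = pi / 2"
    and half: "\<And>j. j < nu \<Longrightarrow> t j \<le> 2 * t (Suc j)"
    and pyth: "\<And>j. j \<in> {1..nu} \<Longrightarrow> pyth_angle (t j) (a j) (b j) (c j)"
  shows "L3 \<subseteq> P_tilde nu t"
proof
  fix x assume "x \<in> L3"
  define r where "r = sqrt ((x $ 1)\<^sup>2 + (x $ 2)\<^sup>2)"
  have r: "0 \<le> r" "r \<le> x $ 3" using \<open>x \<in> L3\<close> by (auto simp: r_def L3_def)
  obtain p where p: "0 \<le> p" "p \<le> pi / 2" "\<bar>x $ 1\<bar> = r * cos p" "\<bar>x $ 2\<bar> = r * sin p"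
  proof (cases "r = 0")
    case True
    then show ?thesis using that[of 0] by (simp add: r_def sum_power2_eq_zero_iff)
  next
    case False
    have "(\<bar>x $ 1\<bar> / r)\<^sup>2 + (\<bar>x $ 2\<bar> / r)\<^sup>2 = ((x $ 1)\<^sup>2 + (x $ 2)\<^sup>2) / r\<^sup>2"
      by (simp add: power_divide add_divide_distrib)
    also have "\<dots> = 1" using False by (simp add: r_def)
    finally obtain p where "0 \<le> p" "p \<le> pi / 2" "\<bar>x $ 1\<bar> / r = cos p" "\<bar>x $ 2\<bar> / r = sin p"
      using sincos_total_pi_half[of "\<bar>x $ 1\<bar> / r" "\<bar>x $ 2\<bar> / r"] r by auto
    then show ?thesis using False by (intro that[of p]) (auto simp: field_simps)
  qed
  define phi where "phi = fold_angle t p"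
  define xi where "xi j = r * cos (phi j)" for j
  define eta where "eta j = r * sin (phi j)" for j
  have phi: "0 \<le> phi j" "phi j \<le> t j" if "j \<le> nu" for j
    using fold_angle_bounds[of p t nu j] p t0 half that by (auto simp: phi_def)
  have step: "xi j = cos (t j) * xi (j - 1) + sin (t j) * eta (j - 1)"
    "eta j \<ge> \<bar>- sin (t j) * xi (j - 1) + cos (t j) * eta (j - 1)\<bar>" if j: "j \<in> {1..nu}" for j
  proof -
    have e: "phi j = \<bar>phi (j - 1) - t j\<bar>" using j by (cases j) (auto simp: phi_def)
    show "xi j = cos (t j) * xi (j - 1) + sin (t j) * eta (j - 1)"
      by (simp add: xi_def eta_def e cos_diff algebra_simps)
    \<comment> \<open>Since \<open>phi j\<close> lies in [0, \<open>t j\<close>], its sine is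
      nonnegative, so the reflected second coordinate equals \<open>eta j\<close> and the inequality
      is tight.\<close>
    have "0 \<le> sin (phi j)"
      using phi[of j] pyth[OF j] j by (intro sin_ge_zero) (auto simp: pyth_angle_def)
    moreover have "\<bar>sin (phi (j - 1) - t j)\<bar> = \<bar>sin (phi j)\<bar>"
      using sin_minus[of "phi (j - 1) - t j"]
      unfolding e by (cases "0 \<le> phi (j - 1) - t j") (simp_all del: sin_minus)
    ultimately have "r * \<bar>sin (phi (j - 1) - t j)\<bar> = eta j" by (simp add: eta_def)
    moreover have "- sin (t j) * xi (j - 1) + cos (t j) * eta (j - 1)
        = r * sin (phi (j - 1) - t j)"
      by (simp add: xi_def eta_def sin_diff algebra_simps)
    ultimately show "eta j \<ge> \<bar>- sin (t j) * xi (j - 1) + cos (t j) * eta (j - 1)\<bar>"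
      using r by (simp add: abs_mult)
  qed
  have le: "xi nu \<le> x $ 3"
    using r mult_left_le[of "cos (phi nu)" r] by (simp add: xi_def)
  \<comment> \<open>Geometrically, the final angle \<open>phi nu\<close> does not exceed
    \<open>t nu\<close>.\<close>
  have "cos (t nu) * eta nu \<le> sin (t nu) * xi nu"
  proof -
    have "0 \<le> sin (t nu - phi nu)"
      using phi[of nu] pyth[of nu] assms(1) by (intro sin_ge_zero) (auto simp: pyth_angle_def)
    then have "0 \<le> r * sin (t nu - phi nu)" using r by simp
    then show ?thesis by (simp add: xi_def eta_def sin_diff algebra_simps)
  qed
  then have "of_int (b nu) * eta nu \<le> of_int (a nu) * xi nu"
    using pyth_angle_rotation_iff(3)[OF pyth] assms(1) by auto
  moreover have "of_int (c j) * xi j = of_int (b j) * xi (j - 1) + of_int (a j) * eta (j - 1)"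
    "of_int (c j) * eta j \<ge> \<bar>- of_int (a j) * xi (j - 1) + of_int (b j) * eta (j - 1)\<bar>"
    if "j \<in> {1..nu}" for j
    using step[OF that] pyth_angle_rotation_iff(1,2)[OF pyth[OF that]] by blast+
  moreover have "xi 0 \<ge> \<bar>x $ 1\<bar>" "eta 0 \<ge> \<bar>x $ 2\<bar>"
    using p by (simp_all add: xi_def eta_def phi_def)
  ultimately show "x \<in> P_tilde nu t"
    unfolding P_tilde_def using pyth le by blast
qed

lemma P_tilde_subset_relaxed_L3:
  assumes "1 \<le> nu"
  shows "P_tilde nu t \<subseteq> relaxed_L3 (1 / cos (t nu))"
proof
  fix x assume "x \<in> P_tilde nu t"
  then obtain a b c xi eta where pyth: "\<And>j. j \<in> {1..nu} \<Longrightarrow> pyth_angle (t j) (a j) (b j) (c j)"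
    and init: "xi 0 \<ge> \<bar>x $ 1\<bar>" "eta 0 \<ge> \<bar>x $ 2\<bar>"
    and step': "\<And>j. j \<in> {1..nu} \<Longrightarrow>
        of_int (c j) * xi j = of_int (b j) * xi (j - 1) + of_int (a j) * eta (j - 1)"
      "\<And>j. j \<in> {1..nu} \<Longrightarrow> of_int (c j) * eta j \<ge>
        \<bar>- of_int (a j) * xi (j - 1) + of_int (b j) * eta (j - 1)\<bar>"
    and last': "xi nu \<le> x $ 3" "of_int (b nu) * eta nu \<le> of_int (a nu) * xi nu"
    unfolding P_tilde_def by blast
  have step: "xi j = cos (t j) * xi (j - 1) + sin (t j) * eta (j - 1)"
    "eta j \<ge> \<bar>- sin (t j) * xi (j - 1) + cos (t j) * eta (j - 1)\<bar>" if "j \<in> {1..nu}" for j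
    using step'[OF that] pyth_angle_rotation_iff(1,2)[OF pyth[OF that]] by blast+
  have last: "cos (t nu) * eta nu \<le> sin (t nu) * xi nu"
    using last'(2) pyth_angle_rotation_iff(3)[OF pyth[of nu]] assms by auto
  \<comment> \<open>The rotation preserves the norm, and replacing the second coordinate by
    something at least its absolute value cannot decrease it.\<close>
  have grow: "(x $ 1)\<^sup>2 + (x $ 2)\<^sup>2 \<le> (xi j)\<^sup>2 + (eta j)\<^sup>2" if "j \<le> nu" for j
    using that
  proof (induction j)
    case 0
    then show ?case using init by (intro add_mono) (simp_all add: abs_le_square_iff[symmetric])
  next
    case (Suc j)
    define s k where "s = sin (t (Suc j))" and "k = cos (t (Suc j))"
    have "s\<^sup>2 + k\<^sup>2 = 1" by (simp add: s_def k_def)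
    have "xi (Suc j) = k * xi j + s * eta j"
      using step(1)[of "Suc j"] Suc.prems by (simp add: s_def k_def)
    moreover have "\<bar>- s * xi j + k * eta j\<bar> \<le> eta (Suc j)"
      using step(2)[of "Suc j"] Suc.prems by (simp add: s_def k_def)
    then have "(- s * xi j + k * eta j)\<^sup>2 \<le> (eta (Suc j))\<^sup>2"
      by (simp add: abs_le_square_iff[symmetric])
    moreover have "(k * xi j + s * eta j)\<^sup>2 + (- s * xi j + k * eta j)\<^sup>2
        = (s\<^sup>2 + k\<^sup>2) * ((xi j)\<^sup>2 + (eta j)\<^sup>2)"
      by (simp add: power2_eq_square algebra_simps)
    ultimately show ?case using Suc \<open>s\<^sup>2 + k\<^sup>2 = 1\<close> by simp
  qed
  have sk: "0 < sin (t nu)" "0 < cos (t nu)"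
    using pyth[of nu] assms by (auto simp: pyth_angle_def intro: sin_gt_zero cos_gt_zero)
  have "0 \<le> eta nu" using step(2)[of nu] assms by fastforce
  \<comment> \<open>The last constraint puts a nonnegative number below
    \<open>sin (t nu) * xi nu\<close>, and the sine is positive.\<close>
  then have xi0: "0 \<le> xi nu"
    using last sk by (smt (verit) mult_nonneg_nonneg zero_le_mult_iff)
  \<comment> \<open>Squaring the last constraint and adding
    \<open>(cos (t nu) * xi nu)\<^sup>2\<close> to both sides bounds the norm by
    \<open>xi nu / cos (t nu)\<close>.\<close>
  have "(cos (t nu) * eta nu)\<^sup>2 \<le> (sin (t nu) * xi nu)\<^sup>2"
    using last sk \<open>0 \<le> eta nu\<close> by (intro power_mono) auto
  then have "(cos (t nu))\<^sup>2 * ((xi nu)\<^sup>2 + (eta nu)\<^sup>2) \<le> ((sin (t nu))\<^sup>2 + (cos (t nu))\<^sup>2) * (xi nu)\<^sup>2"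
    by (simp add: power_mult_distrib algebra_simps del: sin_cos_squared_add sin_cos_squared_add2)
  then have "(xi nu)\<^sup>2 + (eta nu)\<^sup>2 \<le> (xi nu / cos (t nu))\<^sup>2"
    using sk by (simp add: power_divide field_simps)
  then have "(x $ 1)\<^sup>2 + (x $ 2)\<^sup>2 \<le> (xi nu / cos (t nu))\<^sup>2" using grow[of nu] by simp
  then have "sqrt ((x $ 1)\<^sup>2 + (x $ 2)\<^sup>2) \<le> xi nu / cos (t nu)"
    using sk xi0 by (intro real_le_lsqrt) auto
  also have "\<dots> \<le> x $ 3 / cos (t nu)" using last'(1) sk by (intro divide_right_mono) auto
  finally show "x \<in> relaxed_L3 (1 / cos (t nu))" by (simp add: relaxed_L3_def)
qed

text \<open>A positive \<open>l\<close> forces the third coordinate to be nonnegative, so enlarging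
  the factor weakens the constraint.\<close>

lemma relaxed_L3_mono:
  assumes "0 < l" "l \<le> l'"
  shows "relaxed_L3 l \<subseteq> relaxed_L3 l'"
proof
  fix x assume "x \<in> relaxed_L3 l"
  then have x: "sqrt ((x $ 1)\<^sup>2 + (x $ 2)\<^sup>2) \<le> l * x $ 3" by (simp add: relaxed_L3_def)
  have "0 \<le> sqrt ((x $ 1)\<^sup>2 + (x $ 2)\<^sup>2)" by simp
  then have "0 \<le> l * x $ 3" using x by linarith
  then have "0 \<le> x $ 3" using assms(1) by (simp add: zero_le_mult_iff)
  then have "l * x $ 3 \<le> l' * x $ 3" using assms(2) by (intro mult_right_mono)
  then show "x \<in> relaxed_L3 l'" using x by (simp add: relaxed_L3_def)
qed

section \<open>Estimates for the hat angles\<close>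

text \<open>This is the halving condition of \<open>L3_subset_P_tilde\<close>. Cosine decreases on
  [0, pi], and the double-angle formula makes both cosines rational.\<close>

lemma hat_theta_le_double: "hat_theta j \<le> 2 * hat_theta (Suc j)"
proof -
  note pa = pyth_angle_hat[of "Suc j", simplified]
  have rng: "0 < hat_theta (Suc j)" "hat_theta (Suc j) < pi / 2" using pa by (auto simp: pyth_angle_def)
  have j: "0 \<le> hat_theta j" "hat_theta j \<le> pi"
    using pyth_angle_hat[of j] by (cases "j = 0"; force simp: hat_theta_def[of 0] pyth_angle_def)+
  have cd: "cos (2 * hat_theta (Suc j)) = 2 * (of_int (hat_b (Suc j)) / of_int (hat_c (Suc j)))\<^sup>2 - 1"
    using pa by (simp add: cos_double_cos pyth_angle_def)
  consider "j = 0" | "j = 1" | n where "j = Suc (Suc n)"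
    by (metis One_nat_def not0_implies_Suc)
  then have "cos (2 * hat_theta (Suc j)) \<le> cos (hat_theta j)"
  proof cases
    \<comment> \<open>The first angle is just above pi/4: its double has cosine -239/28561.\<close>
    case 1
    then show ?thesis unfolding cd
      by (simp add: hat_theta_def[of 0] hat_b_def hat_c_def power2_eq_square)
  next
    \<comment> \<open>The second triple is (5, 12, 13), and 2 * 12^2 - 13^2 = 119, so the two
      cosines coincide.\<close>
    case 2
    have "cos (hat_theta (Suc 0)) = 119 / 169"
      using pyth_angle_hat[of 1] by (simp add: pyth_angle_def hat_b_def hat_c_def)
    then show ?thesis unfolding cd
      by (simp add: 2 hat_h_def hat_b_def hat_c_def power2_eq_square)
  next
    case 3
    \<comment> \<open>Here \<open>hat_h j = y + 2\<close> and
      \<open>hat_h (Suc j) = 2 * y + 2\<close>; \<open>D\<close> and \<open>C\<close> are the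
      corresponding hypotenuses, each one more than its \<open>hat_b\<close>.\<close>
    define y where "y = (2 :: real) ^ n"
    have y: "1 \<le> y" by (simp add: y_def)
    define C where "C = 2 * (2 * y + 2)\<^sup>2 - 2 * (2 * y + 2) + 1"
    define D where "D = 2 * (y + 2)\<^sup>2 - 2 * (y + 2) + 1"
    have C: "C = 8 * y\<^sup>2 + 12 * y + 5" and D: "D = 2 * y\<^sup>2 + 6 * y + 5"
      by (simp_all add: C_def D_def power2_eq_square algebra_simps)
    have pos: "0 < C" "0 < D" using y by (auto simp: C D intro!: add_pos_pos)
    have "cos (hat_theta j) = of_int (hat_b j) / of_int (hat_c j)"
      using pyth_angle_hat[of j] 3 by (simp add: pyth_angle_def)
    also have "\<dots> = (D - 1) / D" by (simp add: 3 hat_b_def hat_c_def hat_h_def y_def D_def)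
    finally have e1: "cos (hat_theta j) = (D - 1) / D" .
    have e2: "cos (2 * hat_theta (Suc j)) = 2 * ((C - 1) / C)\<^sup>2 - 1"
    proof -
      have "real_of_int (hat_b (Suc j)) = C - 1" "real_of_int (hat_c (Suc j)) = C"
        by (simp_all add: 3 hat_b_def hat_c_def hat_h_def y_def C_def)
      then show ?thesis unfolding cd by simp
    qed
    \<comment> \<open>The claim amounts to 1/D \<le> (4C - 2)/C^2. As polynomials in
      \<open>y\<close>, both sides have leading term 64 y^4, and every lower coefficient is larger
      on the right.\<close>
    have "C\<^sup>2 \<le> D * (4 * C - 2)"
      unfolding C D using y by (simp add: power2_eq_square algebra_simps)
    moreover have "(D - 1) / D - (2 * ((C - 1) / C)\<^sup>2 - 1) = (D * (4 * C - 2) - C\<^sup>2) / (D * C\<^sup>2)"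
      using pos by (simp add: power2_eq_square field_simps)
    ultimately have "0 \<le> (D - 1) / D - (2 * ((C - 1) / C)\<^sup>2 - 1)"
      using pos by simp
    then show ?thesis unfolding e1 e2 by linarith
  qed
  then show ?thesis using j rng cos_mono_le_eq[of "2 * hat_theta (Suc j)" "hat_theta j"] by simp
qed

lemma sec_hat_theta_le:
  assumes "0 < d" "2 \<le> n" "- 6 + 2 * sqrt (1 + 2 / d) \<le> 2 ^ n"
  shows "1 / cos (hat_theta n) \<le> 1 + d"
proof -
  obtain m where n: "n = Suc (Suc m)"
    using \<open>2 \<le> n\<close> by (metis add_2_eq_Suc le_Suc_ex)
  define h where "h = (2 :: real) ^ m + 2"
  define B where "B = 2 * h\<^sup>2 - 2 * h"
  have "1 \<le> (2 :: real) ^ m" by simp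
  then have h: "3 \<le> h" unfolding h_def by linarith
  have "0 < 2 * (h * (h - 1))" using h by simp
  then have B: "0 < B" by (simp add: B_def power2_eq_square algebra_simps)
  \<comment> \<open>The constant -6 fits here: 2^n + 6 = 4 * 2^m + 6 = 2 (2h - 1).\<close>
  have "sqrt (1 + 2 / d) \<le> 2 * h - 1" using assms(3) by (simp add: h_def n)
  then have "1 + 2 / d \<le> (2 * h - 1)\<^sup>2" by (rule sqrt_le_D)
  also have "\<dots> = 1 + 2 * B" by (simp add: B_def power2_eq_square algebra_simps)
  finally have "1 / B \<le> d" using assms(1) B by (simp add: field_simps)
  moreover have "cos (hat_theta n) = B / (B + 1)"
    using pyth_angle_hat[of n] n
    by (simp add: pyth_angle_def hat_b_def hat_c_def hat_h_def h_def B_def)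
  ultimately show ?thesis using B by (simp add: add_divide_distrib)
qed

section \<open>Comparison with the optimal number of steps\<close>

lemma sqrt_le_arcsec:
  assumes "0 < d"
  shows "0 < arcsec (1 + d)" and "sqrt (1 + 2 / d) \<le> 2 / arcsec (1 + d)"
proof -
  define \<alpha> where "\<alpha> = arcsec (1 + d)"
  have \<alpha>: "\<alpha> = arccos (1 / (1 + d))" using arcsec_eq_arccos[of "1 + d"] assms by (simp add: \<alpha>_def)
  have u: "0 < 1 / (1 + d)" "1 / (1 + d) < 1" using assms by auto
  have pos: "0 < \<alpha>" and lt: "\<alpha> < pi / 2"
    using u arccos_less_arccos[of 0 "1 / (1 + d)"] arccos_less_arccos[of "1 / (1 + d)" 1]
    unfolding \<alpha> arccos_1 arccos_0 by linarith+
  then show "0 < arcsec (1 + d)" by (simp add: \<alpha>_def)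
  have "cos \<alpha> = 1 / (1 + d)" unfolding \<alpha> using u by (intro cos_arccos) linarith+
  define s k where "s = sin (\<alpha> / 2)" and "k = cos (\<alpha> / 2)"
  have sk: "0 < s" "0 < k" using pos lt by (auto simp: s_def k_def intro!: sin_gt_zero cos_gt_zero)
  \<comment> \<open>The half-angle formulas give tan^2 (\<alpha>/2) = d / (2 + d), the reciprocal of
    1 + 2/d.\<close>
  have "s\<^sup>2 = (1 - 1 / (1 + d)) / 2" "k\<^sup>2 = (1 + 1 / (1 + d)) / 2"
    using cos_double_cos[of "\<alpha> / 2"] cos_double_sin[of "\<alpha> / 2"] \<open>cos \<alpha> = _\<close>
    by (simp_all add: s_def k_def)
  then have s2: "s\<^sup>2 = d / (2 * (1 + d))" and k2: "k\<^sup>2 = (2 + d) / (2 * (1 + d))"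
    using assms by (simp_all add: field_simps)
  have "(1 + 2 / d) * s\<^sup>2 = k\<^sup>2" using assms by (simp add: s2 k2 distrib_right add_divide_distrib)
  then have "1 + 2 / d = (k / s)\<^sup>2" using sk by (simp add: power_divide eq_divide_eq)
  then have "sqrt (1 + 2 / d) = k / s" using sk by simp
  also have "\<dots> \<le> 2 / \<alpha>"
  proof -
    have "\<alpha> / 2 \<le> tan (\<alpha> / 2)"
      using abs_tan_ge[of "\<alpha> / 2"] tan_gt_zero[of "\<alpha> / 2"] pos lt by simp
    then have "\<alpha> / 2 \<le> s / k" by (simp add: tan_def s_def k_def)
    then show ?thesis using sk pos by (simp add: field_simps)
  qed
  finally show "sqrt (1 + 2 / d) \<le> 2 / arcsec (1 + d)" by (simp add: \<alpha>_def)
qed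

text \<open>The guards reflect the range of \<open>hat_nu d\<close>: it drops below 1 for
  \<open>d\<close> at least 8/45, where the construction has no rotation, and at value 1 the outer
  inclusion fails by \<open>P_tilde_1_not_subset\<close>.\<close>

theorem proposition3:
  fixes d :: real
  assumes "0 < d" and "d < 1 / 4"
  shows "(1 \<le> hat_nu d \<longrightarrow> L3 \<subseteq> P_tilde (nat (hat_nu d)) hat_theta) \<and>
         (2 \<le> hat_nu d \<longrightarrow> P_tilde (nat (hat_nu d)) hat_theta \<subseteq> relaxed_L3 (1 + d)) \<and>
         hat_nu d \<le> nu_opt d + 2"
proof (intro conjI impI)
  define w where "w = - 6 + 2 * sqrt (1 + 2 / d)"
  \<comment> \<open>The bound d < 1/4 is exactly what makes the argument of the logarithm
    positive.\<close>
  have "9 < 1 + 2 / d" using assms by (simp add: field_simps)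
  then have "3 < sqrt (1 + 2 / d)" by (intro real_less_rsqrt) simp
  then have w: "0 < w" by (simp add: w_def)
  show "L3 \<subseteq> P_tilde (nat (hat_nu d)) hat_theta" if "1 \<le> hat_nu d"
    using that hat_theta_le_double pyth_angle_hat
    by (intro L3_subset_P_tilde[of _ _ hat_a hat_b hat_c]) (auto simp: hat_theta_def[of 0])
  show "P_tilde (nat (hat_nu d)) hat_theta \<subseteq> relaxed_L3 (1 + d)" if nu: "2 \<le> hat_nu d"
  proof -
    let ?n = "nat (hat_nu d)"
    have "log 2 w \<le> of_int (hat_nu d)" by (simp add: hat_nu_def w_def)
    then have "log 2 w \<le> real ?n" using nu by simp
    then have "w \<le> 2 ^ ?n" using w by (simp add: log_le_iff powr_realpow)
    then have "1 / cos (hat_theta ?n) \<le> 1 + d"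
      using nu assms by (intro sec_hat_theta_le) (auto simp: w_def)
    moreover have "0 < cos (hat_theta ?n)"
      using pyth_angle_hat[of ?n] nu by (auto simp: pyth_angle_def intro!: cos_gt_zero)
    ultimately show ?thesis
      using P_tilde_subset_relaxed_L3[of ?n hat_theta] relaxed_L3_mono[of "1 / cos (hat_theta ?n)" "1 + d"] nu
      by fastforce
  qed
  define y where "y = pi / (2 * arcsec (1 + d))"
  note \<alpha> = sqrt_le_arcsec[OF assms(1)]
  have y: "0 < y" using \<alpha>(1) by (simp add: y_def)
  \<comment> \<open>Dropping the -6 and using 2 \<le> pi gives w \<le> 4 / arcsec (1 + d) \<le> 4 y;
    the factor 4 becomes the additive 2 after taking logarithms.\<close>
  have "2 / arcsec (1 + d) \<le> pi / arcsec (1 + d)"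
    using \<alpha>(1) pi_ge_two by (intro divide_right_mono) auto
  then have "w \<le> 4 * y" using \<alpha>(2) by (simp add: w_def y_def)
  then have "log 2 w \<le> log 2 (4 * y)" using w by simp
  also have "\<dots> = log 2 (2 ^ 2) + log 2 y" using y by (simp add: log_mult)
  also have "\<dots> = log 2 y + of_int 2" by (subst log_pow_cancel) simp_all
  finally have "\<lceil>log 2 w\<rceil> \<le> \<lceil>log 2 y + of_int 2\<rceil>" by (rule ceiling_mono)
  then show "hat_nu d \<le> nu_opt d + 2" by (simp add: hat_nu_def nu_opt_def w_def y_def)
qed

end
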